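(* Let $q$ be an odd prime and let $n\ge 1$ be an integer. Then $$q^n\sum_{y\in\mathbb{F}_q}{}_{n+1}F_n(y)=(-1)^{n+1}.$$
   Context: $\mathbb{F}_q$ is the finite field with $q$ elements; $\epsilon$ and $\phi$ are the trivial and quadratic multiplicative characters of $\mathbb{F}_q$. Every multiplicative character $\chi$ (including $\epsilon$) is extended to $\mathbb{F}_q$ by $\chi(0)=0$; $\overline{\chi}$ is the inverse character. For multiplicative characters $A,B$: $J(A,B)=\sum_{x\in\mathbb{F}_q}A(x)B(1-x)$ and $\binom{A}{B}=\frac{B(-1)}{q}J(A,\overline{B})$. For $n\ge1$ and $x\in\mathbb{F}_q$, $${}_{n+1}F_n(x):={}_{n+1}F_n\left(\begin{matrix}\phi & \phi & \cdots & \phi\\ & \epsilon & \cdots & \epsilon\end{matrix}\ \middle|\ x\right)=\frac{q}{q-1}\sum_{\chi}\binom{\phi\chi}{\chi}^{n+1}\chi(x),$$ the sum running over all multiplicative characters $\chi$ of $\mathbb{F}_q$. *)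

theory Defs
  imports Complex_Main "HOL-Library.Cardinality" "HOL-Computational_Algebra.Primes"
begin

text \<open>
  The finite field with q elements is modelled by a type of sort \<open>{field, finite}\<close>, so q is
  \<open>CARD('a)\<close>. A multiplicative character is a homomorphism from the group of nonzero elements
  to the group of nonzero complex numbers, extended by 0 at 0 (also for the trivial character).
\<close>

definition mult_chars :: "('a::{field,finite} \<Rightarrow> complex) set" where
  "mult_chars = {\<chi>. \<chi> 0 = 0 \<and> (\<forall>x. x \<noteq> 0 \<longrightarrow> \<chi> x \<noteq> 0) \<and>
                     (\<forall>x y. x \<noteq> 0 \<longrightarrow> y \<noteq> 0 \<longrightarrow> \<chi> (x * y) = \<chi> x * \<chi> y)}"

definition trivial_char :: "'a::{field,finite} \<Rightarrow> complex" where
  "trivial_char x = (if x = 0 then 0 else 1)"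

definition quadratic_char :: "'a::{field,finite} \<Rightarrow> complex" where
  "quadratic_char x = (if x = 0 then 0 else if \<exists>y. x = y^2 then 1 else -1)"

definition char_mult ::
    "('a::{field,finite} \<Rightarrow> complex) \<Rightarrow> ('a \<Rightarrow> complex) \<Rightarrow> 'a \<Rightarrow> complex" where
  "char_mult A B = (\<lambda>x. A x * B x)"

text \<open>Since \<open>inverse 0 = 0\<close>, the inverse character again vanishes at 0.\<close>

definition char_inv :: "('a::{field,finite} \<Rightarrow> complex) \<Rightarrow> 'a \<Rightarrow> complex" where
  "char_inv A = (\<lambda>x. inverse (A x))"

definition jacobi_sum ::
    "('a::{field,finite} \<Rightarrow> complex) \<Rightarrow> ('a \<Rightarrow> complex) \<Rightarrow> complex" where
  "jacobi_sum A B = (\<Sum>x\<in>UNIV. A x * B (1 - x))"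

definition char_binom ::
    "('a::{field,finite} \<Rightarrow> complex) \<Rightarrow> ('a \<Rightarrow> complex) \<Rightarrow> complex" where
  "char_binom A B = B (-1) / of_nat CARD('a) * jacobi_sum A (char_inv B)"

text \<open>
  \<open>hyp_F n x\<close> is the Gaussian hypergeometric function with n + 1 upper parameters equal to the
  quadratic character and n lower parameters equal to the trivial character.
\<close>

definition hyp_F :: "nat \<Rightarrow> 'a::{field,finite} \<Rightarrow> complex" where
  "hyp_F n x = of_nat CARD('a) / (of_nat CARD('a) - 1) *
     (\<Sum>\<chi>\<in>mult_chars. char_binom (char_mult quadratic_char \<chi>) \<chi> ^ (n + 1) * \<chi> x)"

text \<open>The sum over all characters is a genuine finite sum.\<close>

lemma finite_mult_chars: "finite (mult_chars :: ('a::{field,finite} \<Rightarrow> complex) set)"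
proof -
  define N where "N = card (UNIV - {0 :: 'a})"
  let ?R = "insert 0 {z :: complex. z ^ N = 1}"
  have "(1::'a) \<in> UNIV - {0}" by simp
  hence N: "N > 0" unfolding N_def by (metis card_gt_0_iff empty_iff finite)
  have "mult_chars \<subseteq> {\<chi> :: 'a \<Rightarrow> complex. range \<chi> \<subseteq> ?R}"
  proof (rule subsetI, rule CollectI, rule image_subsetI)
    fix \<chi> :: "'a \<Rightarrow> complex" and x
    assume \<chi>: "\<chi> \<in> mult_chars"
    show "\<chi> x \<in> ?R"
    proof (rule ccontr)
      assume "\<chi> x \<notin> ?R"
      hence ne: "\<chi> x ^ N \<noteq> 1" and "\<chi> x \<noteq> 0" by auto
      hence x: "x \<noteq> 0" using \<chi> by (auto simp: mult_chars_def)
      have nz: "(\<Prod>y\<in>UNIV - {0}. \<chi> y) \<noteq> 0" using \<chi> by (auto simp: mult_chars_def)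
      have bij: "bij_betw ((*) x) (UNIV - {0}) (UNIV - {0})"
        by (rule bij_betw_byWitness[where f' = "\<lambda>y. y / x"]) (use x in auto)
      have "(\<Prod>y\<in>UNIV - {0}. \<chi> y) = (\<Prod>y\<in>UNIV - {0}. \<chi> (x * y))"
        by (rule prod.reindex_bij_betw[OF bij, symmetric])
      also have "\<dots> = (\<Prod>y\<in>UNIV - {0}. \<chi> x * \<chi> y)"
        using \<chi> x by (intro prod.cong) (auto simp: mult_chars_def)
      also have "\<dots> = \<chi> x ^ N * (\<Prod>y\<in>UNIV - {0}. \<chi> y)"
        by (simp only: prod.distrib prod_constant N_def)
      finally show False using nz ne by simp
    qed
  qed
  moreover have "finite ?R"
    using N by (simp add: finite_roots_unity)
  hence "finite {\<chi> :: 'a \<Rightarrow> complex. range \<chi> \<subseteq> ?R}"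
    using finite_set_of_finite_funs[of "UNIV :: 'a set" ?R 0] by (simp add: image_subset_iff)
  ultimately show ?thesis by (rule finite_subset)
qed

end

(* Summing over y first annihilates every nontrivial character by orthogonality, so only the
   trivial character contributes, with binom(phi, epsilon) = J(phi, epsilon) / q. Since phi sums
   to 0 over the field, J(phi, epsilon) = - phi(1) = -1. *)
theory Submission imports Defs begin

lemma trivial_char_in_mult_chars: "trivial_char \<in> mult_chars"
  by (auto simp: mult_chars_def trivial_char_def)

lemma sum_trivial_char:
  "(\<Sum>y\<in>UNIV. trivial_char (y::'a::{field,finite})) = of_nat CARD('a) - 1"
proof -
  have "(\<Sum>y\<in>UNIV. trivial_char (y::'a)) = (\<Sum>y\<in>(UNIV::'a set). 1 - (if y = 0 then 1 else 0))"
    by (intro sum.cong) (auto simp: trivial_char_def)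
  then show ?thesis
    by (simp add: sum_subtractf)
qed

text \<open>Multiplication by some \<open>a\<close> with \<open>\<chi> a \<noteq> 1\<close> permutes
  the field, so the sum equals \<open>\<chi> a\<close> times itself and must vanish.\<close>

lemma sum_nontrivial_char:
  fixes \<chi> :: "'a::{field,finite} \<Rightarrow> complex"
  assumes "\<chi> \<in> mult_chars" and "\<chi> \<noteq> trivial_char"
  shows "(\<Sum>y\<in>UNIV. \<chi> y) = 0"
proof -
  \<comment> \<open>Both characters vanish at 0, so they must differ at a nonzero point.\<close>
  from assms obtain a where a: "a \<noteq> 0" "\<chi> a \<noteq> 1"
    by (auto simp: mult_chars_def trivial_char_def fun_eq_iff split: if_splits)
  have bij: "bij_betw ((*) a) UNIV UNIV"
    by (rule bij_betw_byWitness[where f' = "\<lambda>y. y / a"]) (use a in auto)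
  have "(\<Sum>y\<in>UNIV. \<chi> y) = (\<Sum>y\<in>UNIV. \<chi> (a * y))"
    by (rule sum.reindex_bij_betw[OF bij, symmetric])
  also have "\<dots> = (\<Sum>y\<in>UNIV. \<chi> a * \<chi> y)"
  proof (intro sum.cong refl)
    show "\<chi> (a * y) = \<chi> a * \<chi> y" for y
      \<comment> \<open>Multiplicativity is only given on nonzero arguments; at \<open>y = 0\<close>
        both sides are 0.\<close>
      using assms(1) a by (cases "y = 0") (auto simp: mult_chars_def)
  qed
  also have "\<dots> = \<chi> a * (\<Sum>y\<in>UNIV. \<chi> y)"
    by (simp add: sum_distrib_left)
  finally show ?thesis
    using a by simp
qed

text \<open>Translation by 1 permutes the field and so fixes the sum of all its elements, yet adds
  \<open>CARD('a)\<close> copies of 1 to it. Hence \<open>of_nat CARD('a) = 0\<close> in the field,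
  whereas \<open>2 = 0\<close> and odd cardinality would make it 1.\<close>

lemma two_neq_zero_if_odd_CARD:
  assumes "odd CARD('a::{field,finite})"
  shows "(2::'a) \<noteq> 0"
proof
  assume two: "(2::'a) = 0"
  have bij: "bij_betw ((+) 1) (UNIV::'a set) UNIV"
    by (rule bij_betw_byWitness[where f' = "\<lambda>y. y - 1"]) auto
  have "(\<Sum>x\<in>(UNIV::'a set). x) = (\<Sum>x\<in>UNIV. 1 + x)"
    by (rule sum.reindex_bij_betw[OF bij, symmetric])
  then have "(of_nat CARD('a) :: 'a) = 0"
    by (simp add: sum.distrib)
  moreover obtain k where "CARD('a) = 2 * k + 1"
    using assms oddE by blast
  ultimately show False
    using two by simp
qed

text \<open>The square roots of \<open>y^2\<close> are \<open>y\<close> and \<open>- y\<close>,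
  which coincide only for \<open>y = 0\<close> because 2 is invertible.\<close>

lemma card_square_roots:
  fixes x :: "'a::{field,finite}"
  assumes "(2::'a) \<noteq> 0"
  shows "of_nat (card {y. y^2 = x}) = 1 + quadratic_char x"
proof (cases "\<exists>y. x = y^2")
  case True
  then obtain y where y: "x = y^2" by blast
  have roots: "{z. z^2 = x} = {y, - y}"
    by (auto simp: y power2_eq_iff)
  show ?thesis
  proof (cases "y = 0")
    case False
    have "y \<noteq> - y"
    proof
      assume "y = - y"
      then have "2 * y = 0"
        by (metis add.right_inverse mult_2)
      with assms False show False by simp
    qed
    then have "card {z. z^2 = x} = 2"
      by (simp add: roots)
    with False True show ?thesis
      by (simp add: quadratic_char_def y)
  qed (simp add: y quadratic_char_def)
next
  case False
  then have "x \<noteq> 0"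
    by (metis zero_power2)
  moreover have "{y. y^2 = x} = {}"
    using False by auto
  ultimately show ?thesis
    using False by (simp add: quadratic_char_def)
qed

text \<open>Sorting the field elements by their squares gives q as the sum of
  \<open>1 + quadratic_char x\<close> over all x; the ones already account for q.\<close>

lemma sum_quadratic_char:
  assumes "odd CARD('a::{field,finite})"
  shows "(\<Sum>x\<in>(UNIV::'a set). quadratic_char x) = 0"
proof -
  have "CARD('a) = (\<Sum>y\<in>(UNIV::'a set). 1)"
    by simp
  also have "\<dots> = (\<Sum>x\<in>(UNIV::'a set). \<Sum>y\<in>{y\<in>UNIV. y^2 = x}. 1)"
    by (rule sum.group[symmetric]) auto
  also have "\<dots> = (\<Sum>x\<in>(UNIV::'a set). card {y. y^2 = x})"
    by simp
  finally have "(of_nat CARD('a) :: complex) = (\<Sum>x\<in>(UNIV::'a set). of_nat (card {y. y^2 = x}))"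
    by (metis of_nat_sum)
  also have "\<dots> = (\<Sum>x\<in>(UNIV::'a set). 1 + quadratic_char x)"
    by (simp only: card_square_roots[OF two_neq_zero_if_odd_CARD[OF assms]])
  also have "\<dots> = of_nat CARD('a) + (\<Sum>x\<in>(UNIV::'a set). quadratic_char x)"
    by (simp add: sum.distrib)
  finally show ?thesis
    by simp
qed

lemma char_binom_quadratic_trivial:
  assumes "odd CARD('a::{field,finite})"
  shows "char_binom (quadratic_char :: 'a \<Rightarrow> complex) trivial_char = - 1 / of_nat CARD('a)"
proof -
  have one: "quadratic_char (1::'a) = 1"
    by (auto simp: quadratic_char_def intro: exI[of _ 1])
  \<comment> \<open>The factor at \<open>1 - x\<close> is 1 except at \<open>x = 1\<close>, where
    extension by 0 deletes the term \<open>quadratic_char 1 = 1\<close>.\<close>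
  have "jacobi_sum (quadratic_char :: 'a \<Rightarrow> complex) (char_inv trivial_char)
      = (\<Sum>x\<in>(UNIV::'a set). quadratic_char x - (if x = 1 then 1 else 0))"
    unfolding jacobi_sum_def
    by (intro sum.cong) (auto simp: char_inv_def trivial_char_def one)
  also have "\<dots> = - 1"
    by (simp add: sum_subtractf sum_quadratic_char[OF assms])
  finally show ?thesis
    by (simp add: char_binom_def trivial_char_def)
qed

lemma sum_hyp_F:
  "(\<Sum>y\<in>(UNIV::'a::{field,finite} set). hyp_F n y)
    = of_nat CARD('a) * char_binom (quadratic_char :: 'a \<Rightarrow> complex) trivial_char ^ (n + 1)"
proof -
  let ?c = "\<lambda>\<chi> :: 'a \<Rightarrow> complex. char_binom (char_mult quadratic_char \<chi>) \<chi> ^ (n + 1)"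
  \<comment> \<open>A field has at least two elements, so the factor q - 1 from
    \<open>sum_trivial_char\<close> cancels the denominator in \<open>hyp_F\<close>.\<close>
  have "card {0, 1::'a} \<le> CARD('a)"
    by (intro card_mono) auto
  then have ne: "(of_nat CARD('a) :: complex) - 1 \<noteq> 0"
    by auto
  have "(\<Sum>y\<in>(UNIV::'a set). \<Sum>\<chi>\<in>mult_chars. ?c \<chi> * \<chi> y)
      = (\<Sum>\<chi>\<in>mult_chars. ?c \<chi> * (\<Sum>y\<in>UNIV. \<chi> y))"
    by (subst sum.swap) (simp add: sum_distrib_left)
  also have "\<dots> = (\<Sum>\<chi>\<in>{trivial_char}. ?c \<chi> * (\<Sum>y\<in>UNIV. \<chi> y))"
    by (rule sum.mono_neutral_right)
      (auto simp: finite_mult_chars trivial_char_in_mult_chars sum_nontrivial_char)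
  also have "\<dots> = ?c trivial_char * (of_nat CARD('a) - 1)"
    by (simp add: sum_trivial_char)
  also have "char_mult quadratic_char trivial_char = (quadratic_char :: 'a \<Rightarrow> complex)"
    by (auto simp: char_mult_def trivial_char_def quadratic_char_def)
  finally show ?thesis
    unfolding hyp_F_def sum_distrib_left[symmetric] using ne by simp
qed

theorem proposition4p2:
  fixes q n :: nat
  assumes "prime q" and "odd q" and "CARD('a::{field,finite}) = q" and "n \<ge> 1"
  shows "of_nat q ^ n * (\<Sum>y\<in>(UNIV::'a set). hyp_F n y) = (-1) ^ (n + 1)"
proof -
  have "(of_nat q :: complex) \<noteq> 0"
    using assms(2) by (auto intro: Nat.gr0I)
  moreover have "char_binom (quadratic_char :: 'a \<Rightarrow> complex) trivial_char = - 1 / of_nat q"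
    using char_binom_quadratic_trivial[where 'a = 'a] assms(2,3) by simp
  ultimately show ?thesis
    \<comment> \<open>The prefactor \<open>q ^ n\<close> and the extra q from
      \<open>sum_hyp_F\<close> together cancel the denominator of
      \<open>(- 1 / q) ^ (n + 1)\<close>.\<close>
    using assms(3) by (simp only: sum_hyp_F power_divide) (simp add: field_simps)
qed

end
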